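(* Let $T>0$, let $\mathcal{F}:\mathcal{P}_2(\mathbb{R}^d)\to(-\infty,\infty]$ satisfy the standing assumptions in the context, and let $(\rho(t),t\in[0,T])$ be the Wasserstein gradient flow of $\mathcal{F}$. For each $\varepsilon>0$ let $S_\varepsilon^1:\mathcal{P}_2(\mathbb{R}^d)\to\mathcal{P}_2(\mathbb{R}^d)$ be a map of the form $S_\varepsilon^1(\rho)=(\mathrm{Id}+\varepsilon v_\varepsilon)_\#\rho$, with $v_\varepsilon$ a vector field of gradient type that may depend on $\rho$ and $\varepsilon$; let $S_\varepsilon^k$ be its $k$-fold iterate ($S_\varepsilon^0=$ identity map). Set $N_\varepsilon=\lfloor T/\varepsilon\rfloor$, $[N_\varepsilon]=\{1,\dots,N_\varepsilon\}$. Suppose that: (consistency) $$\limsup_{\varepsilon\to0}\ \sup_{t\in[0,T-\varepsilon]}\frac1\varepsilon\mathbb{W}_2\left(S_\varepsilon^1(\rho(t)),\rho(t+\varepsilon)\right)=0;$$ (contraction in the limit) $$\limsup_{\varepsilon\to0}\ \sup_{k\in[N_\varepsilon]}\frac1\varepsilon\Big(\mathbb{W}_2\big(S_\varepsilon^1(S_\varepsilon^k(\rho(0))),S_\varepsilon^1(\rho(k\varepsilon))\big)-\mathbb{W}_2\big(S_\varepsilon^k(\rho(0)),\rho(k\varepsilon)\big)\Big)\le0.$$ Define $\rho_\varepsilon(t)=S_\varepsilon^k(\rho(0))$ for $t\in[k\varepsilon,(k+1)\varepsilon)$, $k=0,1,2,\dots$. Then $\rho_\varepsilon(\cdot)$ is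 a first-order approximation of the gradient flow on $[0,T]$, i.e. $$\lim_{\varepsilon\to0}\ \sup_{t\in[0,T]}\mathbb{W}_2(\rho_\varepsilon(t),\rho(t))=0.$$
   Context: $\mathcal{P}_2(\mathbb{R}^d)$ is the set of Borel probability measures on $\mathbb{R}^d$ with finite second moment, equipped with the Wasserstein-2 distance $\mathbb{W}_2$; $\mathcal{P}_2^{ac}(\mathbb{R}^d)$ is the subset of absolutely continuous measures. Standing assumptions on $\mathcal{F}$: $\mathcal{F}$ is proper, lower semicontinuous and $\lambda$-geodesically convex for some $\lambda\in\mathbb{R}$; with $\partial\mathcal{F}(\rho)$ the (Fréchet) Wasserstein subdifferential at $\rho$ (in the sense of Ambrosio–Gigli–Savaré) and $D(\partial\mathcal{F})$ the set of $\rho$ with $\mathcal{F}(\rho)<\infty$ and $\partial\mathcal{F}(\rho)\neq\emptyset$, one has $D(\partial\mathcal{F})\subset\mathcal{P}_2^{ac}(\mathbb{R}^d)$; there is $\varepsilon_0>0$ such that $\nu\mapsto\mathcal{F}(\nu)+\frac1{2\varepsilon}\mathbb{W}_2^2(\nu,\rho)$ has at least one minimizer for all $\varepsilon\in(0,\varepsilon_0)$ and $\rho\in\mathcal{P}_2(\mathbb{R}^d)$. The Wasserstein gradient $\nabla_{\mathbb{W}}\mathcal{F}(\rho)$ is the unique element of $\partial\mathcal{F}(\rho)$ of minimal $L^2(\rho)$ norm. Gradient flow: it is assumed that the gradient flow $(\rho(t),t\in[0,T])$ exists as an absolutely continuous curve in $(\mathcal{P}_2(\mathbb{R}^d),\mathbb{W}_2)$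 which is the unique solution of $\partial_t\rho(t)+\nabla\cdot(v(t)\rho(t))=0$ with $v(t)=-\nabla_{\mathbb{W}}\mathcal{F}(\rho(t))\in\mathrm{Tan}(\rho(t))$, where $\mathrm{Tan}(\rho)$ is the $L^2(\rho)$-closure of $\{\nabla\varphi:\varphi\in C_c^\infty(\mathbb{R}^d)\}$. *)

theory Defs
  imports "HOL-Probability.Probability"
begin

section \<open>The Wasserstein space\<close>

text \<open>Throughout, the ambient space is an arbitrary \<open>'a::euclidean_space\<close>, i.e. \<open>\<real>\<^sup>d\<close> with
  \<open>d = DIM('a)\<close>. Measures are of type \<open>'a measure\<close>; functionals and maps on the Wasserstein space
  are total functions of which only the values on \<open>P2\<close> matter.\<close>

definition P2 :: "'a::euclidean_space measure set" where
  "P2 = {\<mu>. prob_space \<mu> \<and> sets \<mu> = sets borel \<and> integrable \<mu> (\<lambda>x. (norm x)\<^sup>2)}"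

definition P2_ac :: "'a::euclidean_space measure set" where
  "P2_ac = {\<mu> \<in> P2. absolutely_continuous lborel \<mu>}"

definition couplings ::
  "'a::euclidean_space measure \<Rightarrow> 'a measure \<Rightarrow> ('a \<times> 'a) measure set" where
  "couplings \<mu> \<nu> =
    {\<pi>. prob_space \<pi> \<and> sets \<pi> = sets borel \<and> distr \<pi> borel fst = \<mu> \<and> distr \<pi> borel snd = \<nu>}"

definition transport_cost :: "('a::euclidean_space \<times> 'a) measure \<Rightarrow> ennreal" where
  "transport_cost \<pi> = (\<integral>\<^sup>+ z. ennreal ((dist (fst z) (snd z))\<^sup>2) \<partial>\<pi>)"

text \<open>The infimum is finite whenever \<open>\<mu>, \<nu> \<in> P2\<close>, so the conversion to \<open>real\<close> is harmless there.\<close>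

definition W2 :: "'a::euclidean_space measure \<Rightarrow> 'a measure \<Rightarrow> real" where
  "W2 \<mu> \<nu> = sqrt (enn2real (INF \<pi>\<in>couplings \<mu> \<nu>. transport_cost \<pi>))"

definition optimal_couplings ::
  "'a::euclidean_space measure \<Rightarrow> 'a measure \<Rightarrow> ('a \<times> 'a) measure set" where
  "optimal_couplings \<mu> \<nu> =
    {\<pi> \<in> couplings \<mu> \<nu>. transport_cost \<pi> = (INF \<pi>'\<in>couplings \<mu> \<nu>. transport_cost \<pi>')}"


section \<open>Smooth compactly supported functions\<close>

primrec Ck :: "nat \<Rightarrow> ('b::euclidean_space \<Rightarrow> real) \<Rightarrow> bool" where
  "Ck 0 f \<longleftrightarrow> continuous_on UNIV f"
| "Ck (Suc k) f \<longleftrightarrow> (\<exists>g. (\<forall>x. GDERIV f x :> g x) \<and> (\<forall>b\<in>Basis. Ck k (\<lambda>x. g x \<bullet> b)))"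

definition test_functions :: "'b::euclidean_space set \<Rightarrow> ('b \<Rightarrow> real) set" where
  "test_functions U =
    {\<phi>. (\<forall>k. Ck k \<phi>) \<and> compact (closure (support_on UNIV \<phi>)) \<and> closure (support_on UNIV \<phi>) \<subseteq> U}"

definition grad :: "('b::euclidean_space \<Rightarrow> real) \<Rightarrow> 'b \<Rightarrow> 'b" where
  "grad f x = (THE D. GDERIV f x :> D)"


section \<open>Functionals on the Wasserstein space\<close>

text \<open>Borel representatives of elements of \<open>L\<^sup>2(\<mu>)\<close>, without quotienting by equality almost
  everywhere.\<close>

definition L2_fields :: "'a::euclidean_space measure \<Rightarrow> ('a \<Rightarrow> 'a) set" where
  "L2_fields \<mu> = {\<xi> \<in> borel_measurable borel. integrable \<mu> (\<lambda>x. (norm (\<xi> x))\<^sup>2)}"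

definition tangent_space :: "'a::euclidean_space measure \<Rightarrow> ('a \<Rightarrow> 'a) set" where
  "tangent_space \<mu> =
    {\<xi> \<in> L2_fields \<mu>. \<forall>e>0. \<exists>\<phi>\<in>test_functions UNIV. (LINT x|\<mu>. (norm (\<xi> x - grad \<phi> x))\<^sup>2) < e}"

definition proper_functional :: "('a::euclidean_space measure \<Rightarrow> ereal) \<Rightarrow> bool" where
  "proper_functional F \<longleftrightarrow> (\<forall>\<mu>\<in>P2. F \<mu> \<noteq> -\<infinity>) \<and> (\<exists>\<mu>\<in>P2. F \<mu> < \<infinity>)"

definition W2_lsc :: "('a::euclidean_space measure \<Rightarrow> ereal) \<Rightarrow> bool" where
  "W2_lsc F \<longleftrightarrow>
    (\<forall>\<mu>\<in>P2. \<forall>s. range s \<subseteq> P2 \<longrightarrow> (\<lambda>n::nat. W2 (s n) \<mu>) \<longlonglongrightarrow> 0 \<longrightarrow>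
       F \<mu> \<le> liminf (\<lambda>n. F (s n)))"

text \<open>Ambrosio--Gigli--Savar\'e, Definition 9.1.1: convexity along some constant speed geodesic
  (the displacement interpolation of some optimal coupling) between any two points of finite
  energy.\<close>

definition geodesically_convex ::
  "real \<Rightarrow> ('a::euclidean_space measure \<Rightarrow> ereal) \<Rightarrow> bool" where
  "geodesically_convex l F \<longleftrightarrow>
    (\<forall>\<mu>\<in>P2. \<forall>\<nu>\<in>P2. F \<mu> < \<infinity> \<longrightarrow> F \<nu> < \<infinity> \<longrightarrow>
      (\<exists>\<pi>\<in>optimal_couplings \<mu> \<nu>. \<forall>t\<in>{0..1}.
         F (distr \<pi> borel (\<lambda>z. (1 - t) *\<^sub>R fst z + t *\<^sub>R snd z))
           \<le> ereal (1 - t) * F \<mu> + ereal t * F \<nu> - ereal (l / 2 * t * (1 - t) * (W2 \<mu> \<nu>)\<^sup>2)))"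

text \<open>The Fr\'echet subdifferential, with the \<open>o(W2 \<mu> \<nu>)\<close> remainder spelled out. If \<open>\<mu>\<close> is absolutely
  continuous, the only optimal coupling of \<open>\<mu>\<close> and \<open>\<nu>\<close> is induced by the optimal map \<open>t\<close> from \<open>\<mu>\<close> to
  \<open>\<nu>\<close>, and the infimum is the integral of \<open>\<xi> x \<bullet> (t x - x)\<close> over \<open>\<mu>\<close>, as in
  Ambrosio--Gigli--Savar\'e, Definition 10.1.1. The infimum over optimal couplings is their way
  (Definition 10.3.1) of making sense of this for general \<open>\<mu>\<close>, where no optimal map need
  exist.\<close>

definition subdifferential ::
  "('a::euclidean_space measure \<Rightarrow> ereal) \<Rightarrow> 'a measure \<Rightarrow> ('a \<Rightarrow> 'a) set" where
  "subdifferential F \<mu> =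
    {\<xi> \<in> L2_fields \<mu>. \<forall>\<eta>>0. \<exists>\<delta>>0. \<forall>\<nu>\<in>P2. W2 \<mu> \<nu> < \<delta> \<longrightarrow>
       F \<mu> + (INF \<pi>\<in>optimal_couplings \<mu> \<nu>. ereal (LINT z|\<pi>. \<xi> (fst z) \<bullet> (snd z - fst z)))
         - ereal (\<eta> * W2 \<mu> \<nu>) \<le> F \<nu>}"

definition subdifferential_domain ::
  "('a::euclidean_space measure \<Rightarrow> ereal) \<Rightarrow> 'a measure set" where
  "subdifferential_domain F = {\<mu> \<in> P2. F \<mu> < \<infinity> \<and> subdifferential F \<mu> \<noteq> {}}"

text \<open>A relation rather than a function, since vector fields are determined by their class in
  \<open>L\<^sup>2(\<mu>)\<close> only up to equality almost everywhere.\<close>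

definition wasserstein_gradient ::
  "('a::euclidean_space measure \<Rightarrow> ereal) \<Rightarrow> 'a measure \<Rightarrow> ('a \<Rightarrow> 'a) \<Rightarrow> bool" where
  "wasserstein_gradient F \<mu> \<xi> \<longleftrightarrow>
    \<mu> \<in> subdifferential_domain F \<and> \<xi> \<in> subdifferential F \<mu> \<and>
    (\<forall>\<zeta>\<in>subdifferential F \<mu>. (LINT x|\<mu>. (norm (\<xi> x))\<^sup>2) \<le> (LINT x|\<mu>. (norm (\<zeta> x))\<^sup>2))"

definition proximal_solvable :: "('a::euclidean_space measure \<Rightarrow> ereal) \<Rightarrow> bool" where
  "proximal_solvable F \<longleftrightarrow>
    (\<exists>\<epsilon>0>0. \<forall>\<epsilon>\<in>{0<..<\<epsilon>0}. \<forall>\<mu>\<in>P2. \<exists>\<nu>\<in>P2. \<forall>\<sigma>\<in>P2.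
       F \<nu> + ereal ((W2 \<nu> \<mu>)\<^sup>2 / (2 * \<epsilon>)) \<le> F \<sigma> + ereal ((W2 \<sigma> \<mu>)\<^sup>2 / (2 * \<epsilon>)))"


section \<open>Gradient flows\<close>

definition ac_curve :: "real \<Rightarrow> (real \<Rightarrow> 'a::euclidean_space measure) \<Rightarrow> bool" where
  "ac_curve T \<rho> \<longleftrightarrow>
    (\<forall>t\<in>{0..T}. \<rho> t \<in> P2) \<and>
    (\<exists>m. set_integrable lborel {0..T} m \<and>
       (\<forall>s t. 0 \<le> s \<longrightarrow> s \<le> t \<longrightarrow> t \<le> T \<longrightarrow> W2 (\<rho> s) (\<rho> t) \<le> (LINT r:{s..t}|lborel. m r)))"

text \<open>The continuity equation in the sense of distributions on \<open>(0, T) \<times> \<real>\<^sup>d\<close>. For a test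
  function \<open>\<phi>\<close> of time and space, the two components of \<open>grad \<phi> (t, x)\<close> are the time derivative and
  the spatial gradient.\<close>

definition continuity_equation ::
  "real \<Rightarrow> (real \<Rightarrow> 'a::euclidean_space measure) \<Rightarrow> (real \<Rightarrow> 'a \<Rightarrow> 'a) \<Rightarrow> bool" where
  "continuity_equation T \<rho> v \<longleftrightarrow>
    (\<lambda>(t, x). v t x) \<in> borel_measurable (borel \<Otimes>\<^sub>M borel) \<and>
    (\<integral>\<^sup>+ t\<in>{0<..<T}. (\<integral>\<^sup>+ x. ennreal (norm (v t x)) \<partial>\<rho> t) \<partial>lborel) < \<infinity> \<and>
    (\<forall>\<phi>\<in>test_functions ({0<..<T} \<times> UNIV).
       (LINT t:{0<..<T}|lborel.
          (LINT x|\<rho> t. fst (grad \<phi> (t, x)) + v t x \<bullet> snd (grad \<phi> (t, x)))) = 0)"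

definition gradient_flow ::
  "('a::euclidean_space measure \<Rightarrow> ereal) \<Rightarrow> real \<Rightarrow> (real \<Rightarrow> 'a measure) \<Rightarrow> bool" where
  "gradient_flow F T \<rho> \<longleftrightarrow>
    ac_curve T \<rho> \<and>
    (\<exists>v. continuity_equation T \<rho> v \<and>
       (AE t in lborel. t \<in> {0<..<T} \<longrightarrow>
          v t \<in> tangent_space (\<rho> t) \<and> wasserstein_gradient F (\<rho> t) (\<lambda>x. - v t x)))"


section \<open>One-step schemes\<close>

text \<open>A vector field of gradient type is an element of \<open>tangent_space \<mu>\<close>. This comprises in
  particular the gradients in \<open>L\<^sup>2(\<mu>)\<close> of continuously differentiable functions.\<close>

definition gradient_type_scheme ::
  "(real \<Rightarrow> 'a::euclidean_space measure \<Rightarrow> 'a measure) \<Rightarrow> bool" where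
  "gradient_type_scheme S \<longleftrightarrow>
    (\<forall>\<epsilon>>0. \<forall>\<mu>\<in>P2. S \<epsilon> \<mu> \<in> P2 \<and>
       (\<exists>v\<in>tangent_space \<mu>. S \<epsilon> \<mu> = distr \<mu> borel (\<lambda>x. x + \<epsilon> *\<^sub>R v x)))"

end

theory Submission
  imports Defs
begin

text \<open>
  Let \<open>e\<^sub>k\<close> be the distance between \<open>(S \<epsilon> ^^ k) (\<rho> 0)\<close> and \<open>\<rho> (k \<epsilon>)\<close>. Inserting the
  intermediate point \<open>S \<epsilon> (\<rho> (k \<epsilon>))\<close>, the triangle inequality splits \<open>e\<close> at step \<open>k + 1\<close> into the
  distance of two images under the same step, which is at most \<open>e\<^sub>k + \<eta> \<epsilon>\<close> by contraction in the
  limit, and a one-step error, which is at most \<open>\<eta> \<epsilon>\<close> by consistency. Hence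
  \<open>e\<^sub>k \<le> 2 \<eta> k \<epsilon> \<le> 2 \<eta> T\<close>: there are of order \<open>T / \<epsilon>\<close> steps, so errors \<open>o(\<epsilon>)\<close> per step add up to
  something small. Inside a time cell the scheme is constant while \<open>\<rho>\<close> moves little, because an
  absolutely continuous curve is uniformly continuous (\<open>ac_curve_uniformly_continuous\<close>).

  The substance is therefore the triangle inequality for \<open>W2\<close> (\<open>W2_triangle\<close>). The classical
  proof disintegrates a coupling \<open>\<pi>1\<close> of \<open>\<mu>, \<nu>\<close> and a coupling \<open>\<pi>2\<close> of \<open>\<nu>, \<sigma>\<close> along \<open>\<nu>\<close> and glues
  them. Since the distance is an infimum, an approximate gluing suffices, and that one is explicit:
  cut the space into countably many cells \<open>A\<^sub>i\<close> of diameter less than \<open>r\<close> and give the product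
  measure \<open>\<pi>1 \<Otimes> \<pi>2\<close> of points \<open>((x, y), (y', z))\<close> the density \<open>1 / \<nu>(A\<^sub>i)\<close> where \<open>y\<close> and \<open>y'\<close> lie
  in the same cell \<open>A\<^sub>i\<close>, and \<open>0\<close> elsewhere. Its marginals are exactly \<open>\<pi>1\<close> and \<open>\<pi>2\<close>, so the law
  of \<open>(x, z)\<close> couples \<open>\<mu>\<close> and \<open>\<sigma>\<close>, and \<open>|x - z| \<le> |x - y| + r + |y' - z|\<close> almost surely. The
  \<open>L\<^sup>2\<close> norm of the right-hand side is bounded by the sum of the norms plus \<open>r\<close>, and \<open>r\<close> is
  arbitrary (\<open>approximate_gluing\<close>).
\<close>

section \<open>Gluing two probability spaces along a countable label\<close>

text \<open>
  If the labels \<open>f\<close> and \<open>g\<close> have the same law, this is the law of a pair whose components have laws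
  \<open>M\<close> and \<open>N\<close>, share their label, and are independent given it; the normalising mass may then be
  measured on either side. Labels of mass zero give density \<open>\<infinity>\<close>, but only
  on a null set.
\<close>

definition label_gluing ::
  "'b measure \<Rightarrow> 'c measure \<Rightarrow> ('b \<Rightarrow> nat) \<Rightarrow> ('c \<Rightarrow> nat) \<Rightarrow> ('b \<times> 'c) measure" where
  "label_gluing M N f g =
    density (M \<Otimes>\<^sub>M N)
      (\<lambda>z. if f (fst z) = g (snd z)
           then inverse (emeasure M (f -` {f (fst z)} \<inter> space M)) else 0)"

lemma sets_label_gluing [simp, measurable_cong]:
  "sets (label_gluing M N f g) = sets (M \<Otimes>\<^sub>M N)"
  by (simp add: label_gluing_def)

text \<open>
  Countability of the label type is what makes this work: the coincidence set is a countable union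
  of measurable rectangles.
\<close>

lemma same_label_measurable:
  fixes f :: "'b \<Rightarrow> nat" and g :: "'c \<Rightarrow> nat"
  assumes [measurable]: "f \<in> M \<rightarrow>\<^sub>M count_space UNIV" "g \<in> N \<rightarrow>\<^sub>M count_space UNIV"
  shows "Measurable.pred (M \<Otimes>\<^sub>M N) (\<lambda>z. f (fst z) = g (snd z))"
proof -
  have "Measurable.pred (M \<Otimes>\<^sub>M N) (\<lambda>z. \<exists>i. f (fst z) = i \<and> g (snd z) = i)"
    by measurable
  then show ?thesis
    by (rule back_subst[of "Measurable.pred _"]) auto
qed

lemma AE_label_mass_nonzero:
  fixes f :: "'b \<Rightarrow> nat"
  assumes [measurable]: "f \<in> M \<rightarrow>\<^sub>M count_space UNIV"
  shows "AE w in M. emeasure M (f -` {f w} \<inter> space M) \<noteq> 0"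
proof -
  have "AE w in M. \<forall>i. emeasure M (f -` {i} \<inter> space M) = 0 \<longrightarrow> f w \<noteq> i"
  proof (subst AE_all_countable, rule allI)
    fix i
    show "AE w in M. emeasure M (f -` {i} \<inter> space M) = 0 \<longrightarrow> f w \<noteq> i"
    proof (cases "emeasure M (f -` {i} \<inter> space M) = 0")
      case True
      then show ?thesis
        by (intro AE_I[where N = "f -` {i} \<inter> space M"]) auto
    qed simp
  qed
  then show ?thesis
    by eventually_elim blast
qed

lemma (in finite_measure) nn_integral_same_label:
  fixes f :: "'a \<Rightarrow> nat"
  assumes [measurable]: "f \<in> M \<rightarrow>\<^sub>M count_space UNIV"
    and mass: "emeasure M (f -` {i} \<inter> space M) = m" and "m \<noteq> 0"
  shows "(\<integral>\<^sup>+ w. (if f w = i then inverse m else 0) \<partial>M) = 1"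
proof -
  have "(\<integral>\<^sup>+ w. (if f w = i then inverse m else 0) \<partial>M)
      = (\<integral>\<^sup>+ w. inverse m * indicator (f -` {i} \<inter> space M) w \<partial>M)"
    by (intro nn_integral_cong) (auto simp: indicator_def)
  also have "\<dots> = inverse m * m"
    using mass by (subst nn_integral_cmult_indicator) auto
  also have "\<dots> = 1"
    using assms(3) mass emeasure_finite
    by (metis divide_ennreal_def ennreal_divide_self mult.commute top.not_eq_extremum)
  finally show ?thesis .
qed

text \<open>
  Integrating the density over one variable with the other one fixed replaces the coincidence
  condition by the mass of a single label class, which cancels the normalisation unless that mass is
  zero; points with such labels form a null set. Equality of the label laws makes the argument symmetric.
\<close>

lemma
  fixes f :: "'b \<Rightarrow> nat" and g :: "'c \<Rightarrow> nat"
  assumes M: "prob_space M" and N: "prob_space N"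
    and f [measurable]: "f \<in> M \<rightarrow>\<^sub>M count_space UNIV"
    and g [measurable]: "g \<in> N \<rightarrow>\<^sub>M count_space UNIV"
    and same_law: "distr M (count_space UNIV) f = distr N (count_space UNIV) g"
  shows distr_fst_label_gluing: "distr (label_gluing M N f g) M fst = M"
    and distr_snd_label_gluing: "distr (label_gluing M N f g) N snd = N"
proof -
  interpret M: prob_space M by fact
  interpret N: prob_space N by fact
  interpret pair_sigma_finite M N ..
  define q where "q i = emeasure M (f -` {i} \<inter> space M)" for i
  have qN: "emeasure N (g -` {i} \<inter> space N) = q i" for i
  proof -
    have "q i = emeasure (distr M (count_space UNIV) f) {i}"
      by (simp add: q_def emeasure_distr)
    also have "\<dots> = emeasure N (g -` {i} \<inter> space N)"
      by (simp add: same_law emeasure_distr)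
    finally show ?thesis by simp
  qed
  define h where "h = (\<lambda>z. if f (fst z) = g (snd z) then inverse (q (f (fst z))) else 0)"
  have gl: "label_gluing M N f g = density (M \<Otimes>\<^sub>M N) h"
    unfolding label_gluing_def h_def q_def ..
  note [measurable] = same_label_measurable[OF f g]
  have [measurable]: "(\<lambda>w. q (f w)) \<in> borel_measurable M"
    by (rule measurable_compose[OF f]) simp
  have h [measurable]: "h \<in> borel_measurable (M \<Otimes>\<^sub>M N)"
    unfolding h_def by measurable
  have nzM: "AE w in M. q (f w) \<noteq> 0"
    using AE_label_mass_nonzero[OF f] by (simp add: q_def)
  have nzN: "AE u in N. q (g u) \<noteq> 0"
    using AE_label_mass_nonzero[OF g] by (simp add: qN)
  have oneM: "AE w in M. (\<integral>\<^sup>+ u. h (w, u) \<partial>N) = 1"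
    using nzM
  proof eventually_elim
    case (elim w)
    have "(\<integral>\<^sup>+ u. h (w, u) \<partial>N) = (\<integral>\<^sup>+ u. (if g u = f w then inverse (q (f w)) else 0) \<partial>N)"
      by (intro nn_integral_cong) (auto simp: h_def)
    then show ?case
      using N.nn_integral_same_label[OF g qN elim] by simp
  qed
  have oneN: "AE u in N. (\<integral>\<^sup>+ w. h (w, u) \<partial>M) = 1"
    using nzN
  proof eventually_elim
    case (elim u)
    have "(\<integral>\<^sup>+ w. h (w, u) \<partial>M) = (\<integral>\<^sup>+ w. (if f w = g u then inverse (q (g u)) else 0) \<partial>M)"
      by (intro nn_integral_cong) (simp add: h_def)
    then show ?case
      using M.nn_integral_same_label[OF f q_def[symmetric] elim] by simp
  qed
  show "distr (label_gluing M N f g) M fst = M"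
  proof (rule measure_eqI)
    fix A assume "A \<in> sets (distr (label_gluing M N f g) M fst)"
    then have A [measurable]: "A \<in> sets M" by simp
    have "emeasure (distr (label_gluing M N f g) M fst) A
        = (\<integral>\<^sup>+ x. indicator A x \<partial>distr (label_gluing M N f g) M fst)"
      by simp
    also have "\<dots> = (\<integral>\<^sup>+ z. indicator A (fst z) \<partial>label_gluing M N f g)"
      by (subst nn_integral_distr) auto
    also have "\<dots> = (\<integral>\<^sup>+ z. h z * indicator A (fst z) \<partial>(M \<Otimes>\<^sub>M N))"
      unfolding gl by (subst nn_integral_density) auto
    also have "\<dots> = (\<integral>\<^sup>+ w. (\<integral>\<^sup>+ u. h (w, u) * indicator A w \<partial>N) \<partial>M)"
      by (subst N.nn_integral_fst[symmetric]) auto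
    also have "\<dots> = (\<integral>\<^sup>+ w. (\<integral>\<^sup>+ u. h (w, u) \<partial>N) * indicator A w \<partial>M)"
      by (intro nn_integral_cong nn_integral_multc) simp
    also have "\<dots> = (\<integral>\<^sup>+ w. indicator A w \<partial>M)"
      using oneM by (intro nn_integral_cong_AE) (auto elim: eventually_mono)
    finally show "emeasure (distr (label_gluing M N f g) M fst) A = emeasure M A"
      by simp
  qed simp
  show "distr (label_gluing M N f g) N snd = N"
  proof (rule measure_eqI)
    fix A assume "A \<in> sets (distr (label_gluing M N f g) N snd)"
    then have A [measurable]: "A \<in> sets N" by simp
    have "emeasure (distr (label_gluing M N f g) N snd) A
        = (\<integral>\<^sup>+ x. indicator A x \<partial>distr (label_gluing M N f g) N snd)"
      by simp
    also have "\<dots> = (\<integral>\<^sup>+ z. indicator A (snd z) \<partial>label_gluing M N f g)"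
      by (subst nn_integral_distr) auto
    also have "\<dots> = (\<integral>\<^sup>+ z. h z * indicator A (snd z) \<partial>(M \<Otimes>\<^sub>M N))"
      unfolding gl by (subst nn_integral_density) auto
    also have "\<dots> = (\<integral>\<^sup>+ u. (\<integral>\<^sup>+ w. h (w, u) * indicator A u \<partial>M) \<partial>N)"
      by (subst nn_integral_snd[symmetric]) (auto simp: case_prod_beta)
    also have "\<dots> = (\<integral>\<^sup>+ u. (\<integral>\<^sup>+ w. h (w, u) \<partial>M) * indicator A u \<partial>N)"
      by (intro nn_integral_cong nn_integral_multc) simp
    also have "\<dots> = (\<integral>\<^sup>+ u. indicator A u \<partial>N)"
      using oneN by (intro nn_integral_cong_AE) (auto elim: eventually_mono)
    finally show "emeasure (distr (label_gluing M N f g) N snd) A = emeasure N A"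
      by simp
  qed simp
qed

lemma AE_same_label_in_label_gluing:
  assumes f [measurable]: "f \<in> M \<rightarrow>\<^sub>M count_space UNIV"
    and g [measurable]: "g \<in> N \<rightarrow>\<^sub>M count_space UNIV"
  shows "AE z in label_gluing M N f g. f (fst z) = g (snd z)"
proof -
  define q where "q i = emeasure M (f -` {i} \<inter> space M)" for i
  note [measurable] = same_label_measurable[OF f g]
  have [measurable]: "(\<lambda>w. q (f w)) \<in> borel_measurable M"
    by (rule measurable_compose[OF f]) simp
  have "(\<lambda>z. if f (fst z) = g (snd z) then inverse (q (f (fst z))) else 0)
      \<in> borel_measurable (M \<Otimes>\<^sub>M N)"
    by measurable
  then show ?thesis
    unfolding label_gluing_def q_def[symmetric]
    by (subst AE_density) (auto split: if_splits)
qed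

section \<open>The triangle inequality for the Wasserstein distance\<close>

text \<open>
  The label of a point is the index of the first member of a dense sequence that is within
  \<open>\<delta> / 2\<close> of it.
\<close>

lemma small_cells:
  fixes \<delta> :: real
  assumes "\<delta> > 0"
  obtains c :: "'b::{metric_space, second_countable_topology} \<Rightarrow> nat"
  where "c \<in> borel \<rightarrow>\<^sub>M count_space UNIV" and "\<And>x y. c x = c y \<Longrightarrow> dist x y < \<delta>"
proof -
  obtain D :: "'b set" where D: "countable D" "\<And>X. open X \<Longrightarrow> X \<noteq> {} \<Longrightarrow> \<exists>d\<in>D. d \<in> X"
    using countable_dense_exists by blast
  have "D \<noteq> {}"
    using D(2)[of UNIV] by auto
  define c where "c x = (LEAST n. dist x (from_nat_into D n) < \<delta> / 2)" for x
  have c: "dist x (from_nat_into D (c x)) < \<delta> / 2" for x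
  proof -
    obtain d where "d \<in> D" "dist x d < \<delta> / 2"
      using D(2)[of "ball x (\<delta> / 2)"] assms by auto
    then have "\<exists>n. dist x (from_nat_into D n) < \<delta> / 2"
      using from_nat_into_surj[OF D(1)] by blast
    then show ?thesis
      unfolding c_def by (rule LeastI_ex)
  qed
  show thesis
  proof
    show "c \<in> borel \<rightarrow>\<^sub>M count_space UNIV"
      unfolding c_def by measurable
    show "dist x y < \<delta>" if "c x = c y" for x y
      using c[of x] c[of y] dist_triangle2[of x y "from_nat_into D (c x)"] that by simp
  qed
qed

text \<open>
  A pointwise form of Minkowski's inequality. If \<open>a\<close>, \<open>b\<close>, \<open>c\<close> are functions with \<open>L\<^sup>2\<close> norms at
  most \<open>p\<close>, \<open>q\<close>, \<open>r\<close>, integrating it bounds the squared norm of \<open>a + b + c\<close> by \<open>(p + q + r)\<^sup>2\<close>.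
  The right-hand side is linear in the squares, so it can be integrated termwise.
\<close>

lemma weighted_square_of_sum:
  fixes a b c p q r :: real
  assumes "p > 0" "q > 0" "r > 0"
  shows "(a + b + c)\<^sup>2 \<le> (p + q + r) * (a\<^sup>2 / p + b\<^sup>2 / q + c\<^sup>2 / r)"
proof -
  have "(p + q + r) * (a\<^sup>2 / p + b\<^sup>2 / q + c\<^sup>2 / r) - (a + b + c)\<^sup>2
      = (q * a - p * b)\<^sup>2 / (p * q) + (r * a - p * c)\<^sup>2 / (p * r) + (r * b - q * c)\<^sup>2 / (q * r)"
    using assms by (simp add: field_simps power2_eq_square)
  also have "\<dots> \<ge> 0"
    using assms by simp
  finally show ?thesis by simp
qed

lemma couplingsD:
  assumes "\<pi> \<in> couplings \<mu> \<nu>"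
  shows "prob_space \<pi>" "sets \<pi> = sets borel"
    "distr \<pi> borel fst = \<mu>" "distr \<pi> borel snd = \<nu>"
  using assms by (auto simp: couplings_def)

lemma borel_measurable_fst_snd [measurable]:
  "fst \<in> (borel :: ('a::second_countable_topology \<times> 'b::second_countable_topology) measure) \<rightarrow>\<^sub>M borel"
  "snd \<in> (borel :: ('a::second_countable_topology \<times> 'b::second_countable_topology) measure) \<rightarrow>\<^sub>M borel"
  unfolding borel_prod[symmetric] by measurable

text \<open>
  Composition of two couplings through their common marginal, up to an error \<open>r\<close> that comes from
  joining the two middle points only up to their cell. The bounds \<open>p\<close> and \<open>q\<close> have to be positive
  because they serve as weights in \<open>weighted_square_of_sum\<close>.
\<close>

lemma approximate_gluing:
  fixes \<mu> \<nu> \<sigma> :: "'a::euclidean_space measure" and p q r :: real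
  assumes \<pi>1: "\<pi>1 \<in> couplings \<mu> \<nu>" and \<pi>2: "\<pi>2 \<in> couplings \<nu> \<sigma>"
    and p: "p > 0" "transport_cost \<pi>1 \<le> ennreal (p\<^sup>2)"
    and q: "q > 0" "transport_cost \<pi>2 \<le> ennreal (q\<^sup>2)"
    and r: "r > 0"
  shows "\<exists>\<pi>\<in>couplings \<mu> \<sigma>. transport_cost \<pi> \<le> ennreal ((p + q + r)\<^sup>2)"
proof -
  note m1 = couplingsD[OF \<pi>1] and m2 = couplingsD[OF \<pi>2]
  note [measurable_cong] = m1(2) m2(2)
  interpret \<pi>1: prob_space \<pi>1 by fact
  interpret \<pi>2: prob_space \<pi>2 by fact
  obtain c :: "'a \<Rightarrow> nat" where c [measurable]: "c \<in> borel \<rightarrow>\<^sub>M count_space UNIV"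
    and cell: "\<And>x y. c x = c y \<Longrightarrow> dist x y < r"
    using small_cells[OF r] by blast
  have [measurable]: "fst \<in> \<pi>1 \<rightarrow>\<^sub>M borel" "snd \<in> \<pi>1 \<rightarrow>\<^sub>M borel"
    "fst \<in> \<pi>2 \<rightarrow>\<^sub>M borel" "snd \<in> \<pi>2 \<rightarrow>\<^sub>M borel"
    by measurable
  have f: "(\<lambda>w. c (snd w)) \<in> \<pi>1 \<rightarrow>\<^sub>M count_space UNIV"
    and g: "(\<lambda>u. c (fst u)) \<in> \<pi>2 \<rightarrow>\<^sub>M count_space UNIV"
    by measurable
  \<comment> \<open>Both labels are the cell of a point with law \<open>\<nu>\<close>.\<close>
  have law: "distr \<pi>1 (count_space UNIV) (\<lambda>w. c (snd w))
      = distr \<pi>2 (count_space UNIV) (\<lambda>u. c (fst u))"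
  proof -
    have "distr \<pi>1 (count_space UNIV) (\<lambda>w. c (snd w)) = distr \<nu> (count_space UNIV) c"
      unfolding m1(4)[symmetric] by (subst distr_distr) (auto simp: comp_def)
    also have "\<dots> = distr \<pi>2 (count_space UNIV) (\<lambda>u. c (fst u))"
      unfolding m2(3)[symmetric] by (subst distr_distr) (auto simp: comp_def)
    finally show ?thesis .
  qed
  define \<gamma> where "\<gamma> = label_gluing \<pi>1 \<pi>2 (\<lambda>w. c (snd w)) (\<lambda>u. c (fst u))"
  have g1: "distr \<gamma> \<pi>1 fst = \<pi>1" and g2: "distr \<gamma> \<pi>2 snd = \<pi>2"
    using distr_fst_label_gluing[OF m1(1) m2(1) f g law]
      distr_snd_label_gluing[OF m1(1) m2(1) f g law] by (simp_all add: \<gamma>_def)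
  have [measurable_cong]: "sets \<gamma> = sets (\<pi>1 \<Otimes>\<^sub>M \<pi>2)"
    by (simp add: \<gamma>_def)
  have pg: "prob_space \<gamma>"
    using \<pi>1.prob_space_axioms g1 prob_space_distrD[of fst \<gamma> \<pi>1] by simp
  then interpret \<gamma>: prob_space \<gamma> .
  have \<gamma>_cell: "AE z in \<gamma>. dist (snd (fst z)) (fst (snd z)) < r"
    using AE_same_label_in_label_gluing[OF f g] cell unfolding \<gamma>_def
    by (auto elim: eventually_mono)
  define \<pi> where "\<pi> = distr \<gamma> borel (\<lambda>z. (fst (fst z), snd (snd z)))"
  have pm [measurable]: "(\<lambda>z. (fst (fst z), snd (snd z))) \<in> \<gamma> \<rightarrow>\<^sub>M borel"
    unfolding borel_prod[symmetric] by measurable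
  have "\<pi> \<in> couplings \<mu> \<sigma>"
  proof -
    have "distr \<pi> borel fst = distr (distr \<gamma> \<pi>1 fst) borel fst"
      unfolding \<pi>_def by (subst (1 2) distr_distr) (auto simp: comp_def)
    moreover have "distr \<pi> borel snd = distr (distr \<gamma> \<pi>2 snd) borel snd"
      unfolding \<pi>_def by (subst (1 2) distr_distr) (auto simp: comp_def)
    moreover have "prob_space \<pi>"
      unfolding \<pi>_def by (rule \<gamma>.prob_space_distr) measurable
    ultimately show ?thesis
      using m1(3) m2(4) g1 g2 by (simp add: couplings_def \<pi>_def)
  qed
  moreover have "transport_cost \<pi> \<le> ennreal ((p + q + r)\<^sup>2)"
  proof -
    let ?a = "\<lambda>z. dist (fst (fst z)) (snd (fst z)) :: real"
    let ?b = "\<lambda>z. dist (fst (snd z)) (snd (snd z)) :: real"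
    have I1: "(\<integral>\<^sup>+ z. ennreal ((?a z)\<^sup>2) \<partial>\<gamma>) = transport_cost \<pi>1"
    proof -
      have "transport_cost \<pi>1 = transport_cost (distr \<gamma> \<pi>1 fst)"
        by (simp only: g1)
      also have "\<dots> = (\<integral>\<^sup>+ z. ennreal ((?a z)\<^sup>2) \<partial>\<gamma>)"
        unfolding transport_cost_def by (subst nn_integral_distr) auto
      finally show ?thesis by simp
    qed
    have I2: "(\<integral>\<^sup>+ z. ennreal ((?b z)\<^sup>2) \<partial>\<gamma>) = transport_cost \<pi>2"
    proof -
      have "transport_cost \<pi>2 = transport_cost (distr \<gamma> \<pi>2 snd)"
        by (simp only: g2)
      also have "\<dots> = (\<integral>\<^sup>+ z. ennreal ((?b z)\<^sup>2) \<partial>\<gamma>)"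
        unfolding transport_cost_def by (subst nn_integral_distr) auto
      finally show ?thesis by simp
    qed
    let ?s = "p + q + r"
    have split: "ennreal (?s / p * x + ?s / q * y + ?s * r)
        = ennreal (?s / p) * ennreal x + ennreal (?s / q) * ennreal y + ennreal (?s * r)"
      if "x \<ge> 0" "y \<ge> 0" for x y
    proof -
      have "0 \<le> ?s / p" "0 \<le> ?s / q" "0 \<le> ?s * r"
        using p(1) q(1) r by simp_all
      with that show ?thesis
        by (simp only: ennreal_plus ennreal_mult add_nonneg_nonneg mult_nonneg_nonneg)
    qed
    have bound: "ennreal ((dist (fst (fst z)) (snd (snd z)))\<^sup>2)
        \<le> ennreal (?s / p) * ennreal ((?a z)\<^sup>2)
          + ennreal (?s / q) * ennreal ((?b z)\<^sup>2) + ennreal (?s * r)"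
      if z: "dist (snd (fst z)) (fst (snd z)) < r" for z :: "('a \<times> 'a) \<times> ('a \<times> 'a)"
    proof -
      have "dist (fst (fst z)) (snd (snd z)) \<le> ?a z + ?b z + r"
        using z dist_triangle[of "fst (fst z)" "snd (snd z)" "snd (fst z)"]
          dist_triangle[of "snd (fst z)" "snd (snd z)" "fst (snd z)"] by linarith
      then have "(dist (fst (fst z)) (snd (snd z)))\<^sup>2 \<le> (?a z + ?b z + r)\<^sup>2"
        by (rule power_mono) simp
      also have "\<dots> \<le> ?s * ((?a z)\<^sup>2 / p + (?b z)\<^sup>2 / q + r\<^sup>2 / r)"
        by (rule weighted_square_of_sum[OF p(1) q(1) r])
      also have "\<dots> = ?s / p * (?a z)\<^sup>2 + ?s / q * (?b z)\<^sup>2 + ?s * r"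
        using p q r by (simp add: algebra_simps power2_eq_square)
      finally have "ennreal ((dist (fst (fst z)) (snd (snd z)))\<^sup>2)
          \<le> ennreal (?s / p * (?a z)\<^sup>2 + ?s / q * (?b z)\<^sup>2 + ?s * r)"
        by (rule ennreal_leI)
      also have "\<dots> = ennreal (?s / p) * ennreal ((?a z)\<^sup>2)
          + ennreal (?s / q) * ennreal ((?b z)\<^sup>2) + ennreal (?s * r)"
        by (rule split) simp_all
      finally show ?thesis .
    qed
    have "transport_cost \<pi> = (\<integral>\<^sup>+ z. ennreal ((dist (fst (fst z)) (snd (snd z)))\<^sup>2) \<partial>\<gamma>)"
      unfolding transport_cost_def \<pi>_def by (subst nn_integral_distr) auto
    also have "\<dots> \<le> (\<integral>\<^sup>+ z. ennreal (?s / p) * ennreal ((?a z)\<^sup>2)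
        + ennreal (?s / q) * ennreal ((?b z)\<^sup>2) + ennreal (?s * r) \<partial>\<gamma>)"
      using \<gamma>_cell bound by (intro nn_integral_mono_AE) (rule eventually_mono)
    also have "\<dots> = ennreal (?s / p) * transport_cost \<pi>1
        + ennreal (?s / q) * transport_cost \<pi>2 + ennreal (?s * r)"
      by (simp add: nn_integral_add nn_integral_cmult I1 I2 \<gamma>.emeasure_space_1)
    also have "\<dots> \<le> ennreal (?s / p) * ennreal (p\<^sup>2)
        + ennreal (?s / q) * ennreal (q\<^sup>2) + ennreal (?s * r)"
      using p q by (intro add_mono mult_left_mono) auto
    also have "\<dots> = ennreal (?s / p * p\<^sup>2 + ?s / q * q\<^sup>2 + ?s * r)"
      by (rule split[symmetric]) simp_all
    also have "?s / p * p\<^sup>2 + ?s / q * q\<^sup>2 + ?s * r = ?s\<^sup>2"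
    proof -
      have "?s / p * p\<^sup>2 = ?s * p" "?s / q * q\<^sup>2 = ?s * q"
        using p(1) q(1) by (simp_all add: power2_eq_square)
      then show ?thesis
        by (simp only: power2_eq_square distrib_left)
    qed
    finally show ?thesis .
  qed
  ultimately show ?thesis by blast
qed

lemma W2_nonneg: "W2 \<mu> \<nu> \<ge> 0"
  by (simp add: W2_def)

text \<open>
  The independent coupling has finite cost, since \<open>|x - y|\<^sup>2 \<le> 2 |x|\<^sup>2 + 2 |y|\<^sup>2\<close>. This is needed
  because the conversion to \<open>real\<close> in \<open>W2\<close> sends an infinite infimum to \<open>0\<close>.
\<close>

lemma finite_transport_cost:
  fixes \<mu> \<nu> :: "'a::euclidean_space measure"
  assumes "\<mu> \<in> P2" "\<nu> \<in> P2"
  shows "(INF \<pi>\<in>couplings \<mu> \<nu>. transport_cost \<pi>) < \<infinity>"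
proof -
  have pm: "prob_space \<mu>" "sets \<mu> = sets borel" "integrable \<mu> (\<lambda>x. (norm x)\<^sup>2)"
    and pn: "prob_space \<nu>" "sets \<nu> = sets borel" "integrable \<nu> (\<lambda>x. (norm x)\<^sup>2)"
    using assms by (auto simp: P2_def)
  note [measurable_cong] = pm(2) pn(2)
  interpret \<mu>: prob_space \<mu> by fact
  interpret \<nu>: prob_space \<nu> by fact
  interpret pair_prob_space \<mu> \<nu> ..
  have fin: "(\<integral>\<^sup>+ x. ennreal ((norm x)\<^sup>2) \<partial>\<mu>) < \<infinity>" "(\<integral>\<^sup>+ x. ennreal ((norm x)\<^sup>2) \<partial>\<nu>) < \<infinity>"
    using pm(3) pn(3) by (simp_all add: integrable_iff_bounded)
  have s: "sets (\<mu> \<Otimes>\<^sub>M \<nu>) = sets borel"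
    unfolding borel_prod[symmetric] by (rule sets_pair_measure_cong[OF pm(2) pn(2)])
  have "distr (\<mu> \<Otimes>\<^sub>M \<nu>) borel fst = distr (\<mu> \<Otimes>\<^sub>M \<nu>) \<mu> fst"
    by (rule distr_cong) (auto simp: pm(2))
  moreover have "distr (\<mu> \<Otimes>\<^sub>M \<nu>) borel snd = distr (\<mu> \<Otimes>\<^sub>M \<nu>) \<nu> snd"
    by (rule distr_cong) (auto simp: pn(2))
  moreover have "distr (\<mu> \<Otimes>\<^sub>M \<nu>) \<nu> snd = \<nu>"
  proof (rule measure_eqI)
    fix A assume "A \<in> sets (distr (\<mu> \<Otimes>\<^sub>M \<nu>) \<nu> snd)"
    then have A [measurable]: "A \<in> sets \<nu>" by simp
    have "snd -` A \<inter> space (\<mu> \<Otimes>\<^sub>M \<nu>) = space \<mu> \<times> A"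
      using sets.sets_into_space[OF A] by (auto simp: space_pair_measure)
    then show "emeasure (distr (\<mu> \<Otimes>\<^sub>M \<nu>) \<nu> snd) A = emeasure \<nu> A"
      by (simp add: emeasure_distr \<nu>.emeasure_pair_measure_Times \<mu>.emeasure_space_1)
  qed simp
  ultimately have "\<mu> \<Otimes>\<^sub>M \<nu> \<in> couplings \<mu> \<nu>"
    using \<nu>.distr_pair_fst[of \<mu>] s prob_space_axioms by (simp add: couplings_def)
  moreover have "transport_cost (\<mu> \<Otimes>\<^sub>M \<nu>) < \<infinity>"
  proof -
    have "transport_cost (\<mu> \<Otimes>\<^sub>M \<nu>)
        = (\<integral>\<^sup>+ x. (\<integral>\<^sup>+ y. ennreal ((dist x y)\<^sup>2) \<partial>\<nu>) \<partial>\<mu>)"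
      unfolding transport_cost_def by (subst \<nu>.nn_integral_fst[symmetric]) auto
    also have "\<dots> \<le> (\<integral>\<^sup>+ x. (\<integral>\<^sup>+ y. 2 * ennreal ((norm x)\<^sup>2) + 2 * ennreal ((norm y)\<^sup>2) \<partial>\<nu>) \<partial>\<mu>)"
    proof (intro nn_integral_mono)
      fix x y :: 'a
      have "(dist x y)\<^sup>2 \<le> (norm x + norm y)\<^sup>2"
        by (intro power_mono) (auto simp: dist_norm norm_triangle_ineq4)
      also have "\<dots> \<le> 2 * (norm x)\<^sup>2 + 2 * (norm y)\<^sup>2"
        using sum_squares_bound[of "norm x" "norm y"] by (simp add: power2_sum)
      finally show "ennreal ((dist x y)\<^sup>2) \<le> 2 * ennreal ((norm x)\<^sup>2) + 2 * ennreal ((norm y)\<^sup>2)"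
        by (simp flip: ennreal_mult' ennreal_plus ennreal_numeral)
    qed
    also have "\<dots> = 2 * (\<integral>\<^sup>+ x. ennreal ((norm x)\<^sup>2) \<partial>\<mu>) + 2 * (\<integral>\<^sup>+ x. ennreal ((norm x)\<^sup>2) \<partial>\<nu>)"
      by (simp add: nn_integral_add nn_integral_cmult \<mu>.emeasure_space_1 \<nu>.emeasure_space_1)
    also have "\<dots> < \<infinity>"
      using fin by (simp add: ennreal_mult_less_top)
    finally show ?thesis .
  qed
  ultimately show ?thesis
    by (meson INF_lower le_less_trans)
qed

lemma W2_le_of_coupling:
  assumes "\<pi> \<in> couplings \<mu> \<nu>" "transport_cost \<pi> \<le> ennreal (r\<^sup>2)" "r \<ge> 0"
  shows "W2 \<mu> \<nu> \<le> r"
proof -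
  have "(INF \<pi>\<in>couplings \<mu> \<nu>. transport_cost \<pi>) \<le> ennreal (r\<^sup>2)"
    using assms by (meson INF_lower2)
  then have "enn2real (INF \<pi>\<in>couplings \<mu> \<nu>. transport_cost \<pi>) \<le> r\<^sup>2"
    by (simp add: enn2real_leI)
  then show ?thesis
    unfolding W2_def using assms(3) by (simp add: real_le_lsqrt)
qed

lemma coupling_of_W2_less:
  assumes "\<mu> \<in> P2" "\<nu> \<in> P2" "W2 \<mu> \<nu> < r"
  shows "\<exists>\<pi>\<in>couplings \<mu> \<nu>. transport_cost \<pi> \<le> ennreal (r\<^sup>2)"
proof -
  define I where "I = (INF \<pi>\<in>couplings \<mu> \<nu>. transport_cost \<pi>)"
  have "I < \<infinity>"
    unfolding I_def using assms by (intro finite_transport_cost)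
  have "enn2real I < r\<^sup>2"
    using assms(3) unfolding W2_def I_def[symmetric]
    by (metis enn2real_nonneg real_sqrt_ge_0_iff real_sqrt_less_iff real_sqrt_abs abs_of_nonneg
        less_imp_le order_trans)
  then have "I < ennreal (r\<^sup>2)"
    using \<open>I < \<infinity>\<close>
    by (metis enn2real_nonneg ennreal_enn2real ennreal_lessI infinity_ennreal_def le_less_trans)
  then show ?thesis
    unfolding I_def by (auto simp: INF_less_iff intro: less_imp_le)
qed

lemma W2_triangle:
  fixes \<mu> \<nu> \<sigma> :: "'a::euclidean_space measure"
  assumes "\<mu> \<in> P2" "\<nu> \<in> P2" "\<sigma> \<in> P2"
  shows "W2 \<mu> \<sigma> \<le> W2 \<mu> \<nu> + W2 \<nu> \<sigma>"
proof (rule field_le_epsilon)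
  fix e :: real assume "e > 0"
  define d where "d = e / 3"
  have "d > 0" using \<open>e > 0\<close> by (simp add: d_def)
  define p where "p = W2 \<mu> \<nu> + d"
  define q where "q = W2 \<nu> \<sigma> + d"
  have pos: "p > 0" "q > 0"
    using W2_nonneg[of \<mu> \<nu>] W2_nonneg[of \<nu> \<sigma>] \<open>d > 0\<close> by (simp_all add: p_def q_def)
  obtain \<pi>1 where \<pi>1: "\<pi>1 \<in> couplings \<mu> \<nu>" "transport_cost \<pi>1 \<le> ennreal (p\<^sup>2)"
    using coupling_of_W2_less[of \<mu> \<nu> p] assms \<open>d > 0\<close> by (auto simp: p_def)
  obtain \<pi>2 where \<pi>2: "\<pi>2 \<in> couplings \<nu> \<sigma>" "transport_cost \<pi>2 \<le> ennreal (q\<^sup>2)"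
    using coupling_of_W2_less[of \<nu> \<sigma> q] assms \<open>d > 0\<close> by (auto simp: q_def)
  obtain \<pi> where "\<pi> \<in> couplings \<mu> \<sigma>" "transport_cost \<pi> \<le> ennreal ((p + q + d)\<^sup>2)"
    using approximate_gluing[OF \<pi>1(1) \<pi>2(1) pos(1) \<pi>1(2) pos(2) \<pi>2(2) \<open>d > 0\<close>] by blast
  then have "W2 \<mu> \<sigma> \<le> p + q + d"
    using pos \<open>d > 0\<close> by (intro W2_le_of_coupling) auto
  then show "W2 \<mu> \<sigma> \<le> W2 \<mu> \<nu> + W2 \<nu> \<sigma> + e"
    by (simp add: p_def q_def d_def)
qed

lemma W2_self:
  fixes \<mu> :: "'a::euclidean_space measure"
  assumes "\<mu> \<in> P2"
  shows "W2 \<mu> \<mu> = 0"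
proof -
  have pm: "prob_space \<mu>" "sets \<mu> = sets borel"
    using assms by (auto simp: P2_def)
  note [measurable_cong] = pm(2)
  interpret \<mu>: prob_space \<mu> by fact
  have [measurable]: "(\<lambda>x. (x, x)) \<in> \<mu> \<rightarrow>\<^sub>M borel"
    unfolding borel_prod[symmetric] by measurable
  let ?\<pi> = "distr \<mu> borel (\<lambda>x. (x, x))"
  have "?\<pi> \<in> couplings \<mu> \<mu>"
    using distr_id2[OF pm(2)[symmetric]]
    by (auto simp: couplings_def \<mu>.prob_space_distr distr_distr comp_def)
  moreover have "transport_cost ?\<pi> \<le> ennreal (0\<^sup>2)"
    unfolding transport_cost_def by (subst nn_integral_distr) auto
  ultimately have "W2 \<mu> \<mu> \<le> 0"
    by (rule W2_le_of_coupling) simp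
  then show ?thesis
    using W2_nonneg[of \<mu> \<mu>] by simp
qed

section \<open>Propagation of one-step errors\<close>

text \<open>
  The integral of the density \<open>m\<close> is a continuous function of its upper limit on a compact interval,
  so its increments, which dominate the distances, are uniformly small.
\<close>

lemma ac_curve_uniformly_continuous:
  assumes "ac_curve T \<rho>" "e > 0"
  obtains d where "d > 0"
    "\<And>s t. 0 \<le> s \<Longrightarrow> s \<le> t \<Longrightarrow> t \<le> T \<Longrightarrow> t - s < d \<Longrightarrow> W2 (\<rho> s) (\<rho> t) < e"
proof -
  obtain m where m: "set_integrable lborel {0..T} m"
    and W: "\<And>s t. 0 \<le> s \<Longrightarrow> s \<le> t \<Longrightarrow> t \<le> T \<Longrightarrow> W2 (\<rho> s) (\<rho> t) \<le> (LINT r:{s..t}|lborel. m r)"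
    using assms(1) unfolding ac_curve_def by blast
  have int: "m integrable_on {0..T}"
    using set_borel_integral_eq_integral(1)[OF m] .
  have "uniformly_continuous_on {0..T} (\<lambda>x. integral {0..x} m)"
    by (intro compact_uniformly_continuous indefinite_integral_continuous_1 int compact_Icc)
  then obtain d where d: "d > 0"
    "\<And>s t. s \<in> {0..T} \<Longrightarrow> t \<in> {0..T} \<Longrightarrow> dist t s < d
      \<Longrightarrow> dist (integral {0..t} m) (integral {0..s} m) < e"
    unfolding uniformly_continuous_on_def using assms(2) by metis
  show thesis
  proof
    show "d > 0" by fact
    fix s t :: real assume st: "0 \<le> s" "s \<le> t" "t \<le> T" "t - s < d"
    have "set_integrable lborel {s..t} m"
      using m by (rule set_integrable_subset) (use st in auto)
    then have "(LINT r:{s..t}|lborel. m r) = integral {s..t} m"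
      by (rule set_borel_integral_eq_integral(2))
    also have "\<dots> = integral {0..t} m - integral {0..s} m"
      using Henstock_Kurzweil_Integration.integral_combine[of 0 s t m]
        integrable_on_subinterval[OF int, of 0 t] st by simp
    also have "\<dots> < e"
      using d(2)[of s t] st by (simp add: dist_real_def)
    finally show "W2 (\<rho> s) (\<rho> t) < e"
      using W[of s t] st by simp
  qed
qed

lemma error_accumulation:
  fixes err :: "nat \<Rightarrow> real"
  assumes "err 0 \<le> 0" "\<And>k. k < n \<Longrightarrow> err (Suc k) \<le> err k + c" "k \<le> n"
  shows "err k \<le> real k * c"
  using assms(3)
proof (induction k)
  case (Suc k)
  then show ?case
    using assms(2)[of k] by (simp add: algebra_simps)
qed (use assms(1) in simp)

lemma scheme_iterate_in_P2:
  assumes "gradient_type_scheme S" "\<epsilon> > 0" "\<mu> \<in> P2"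
  shows "(S \<epsilon> ^^ k) \<mu> \<in> P2"
  using assms by (induction k) (auto simp: gradient_type_scheme_def)

lemma tendsto_of_small_SUP:
  fixes f :: "'b \<Rightarrow> 'c \<Rightarrow> real"
  assumes small: "\<And>e. e > 0 \<Longrightarrow> eventually (\<lambda>x. \<forall>t\<in>A. f x t \<le> e) G"
    and nonneg: "\<And>x t. t \<in> A \<Longrightarrow> 0 \<le> f x t" and "A \<noteq> {}"
  shows "((\<lambda>x. SUP t\<in>A. ereal (f x t)) \<longlongrightarrow> 0) G"
proof (rule order_tendstoI)
  fix a :: ereal assume "a < 0"
  obtain t where "t \<in> A" using \<open>A \<noteq> {}\<close> by blast
  have "0 \<le> (SUP t\<in>A. ereal (f x t))" for x
    using nonneg[OF \<open>t \<in> A\<close>] by (intro SUP_upper2[OF \<open>t \<in> A\<close>]) simp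
  then show "eventually (\<lambda>x. a < (SUP t\<in>A. ereal (f x t))) G"
    using less_le_trans[OF \<open>a < 0\<close>] by (intro always_eventually allI) blast
next
  fix a :: ereal assume "0 < a"
  then obtain e where e: "0 < ereal e" "ereal e < a"
    using ereal_dense2 by blast
  then have "eventually (\<lambda>x. \<forall>t\<in>A. f x t \<le> e) G"
    by (intro small) simp
  then show "eventually (\<lambda>x. (SUP t\<in>A. ereal (f x t)) < a) G"
  proof eventually_elim
    case (elim x)
    then have "(SUP t\<in>A. ereal (f x t)) \<le> ereal e"
      by (intro SUP_least) simp
    then show ?case
      using e by simp
  qed
qed

theorem theorem3:
  fixes F :: "'a::euclidean_space measure \<Rightarrow> ereal"
    and lam T :: real
    and \<rho> :: "real \<Rightarrow> 'a measure"
    and S :: "real \<Rightarrow> 'a measure \<Rightarrow> 'a measure"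
    and \<rho>\<epsilon> :: "real \<Rightarrow> real \<Rightarrow> 'a measure"
  assumes T_pos: "T > 0"
    and proper: "proper_functional F"
    and lsc: "W2_lsc F"
    and convex: "geodesically_convex lam F"
    and domain_ac: "subdifferential_domain F \<subseteq> P2_ac"
    and proximal: "proximal_solvable F"
    and flow: "gradient_flow F T \<rho>"
    and flow_unique:
      "\<And>\<sigma> t. gradient_flow F T \<sigma> \<Longrightarrow> \<sigma> 0 = \<rho> 0 \<Longrightarrow> t \<in> {0..T} \<Longrightarrow> \<sigma> t = \<rho> t"
    and scheme: "gradient_type_scheme S"
    and consistency:
      "Limsup (at_right 0)
         (\<lambda>\<epsilon>. SUP t\<in>{0..T - \<epsilon>}. ereal (1 / \<epsilon> * W2 (S \<epsilon> (\<rho> t)) (\<rho> (t + \<epsilon>)))) = 0"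
    and contraction:
      "Limsup (at_right 0)
         (\<lambda>\<epsilon>. SUP k\<in>{1..nat \<lfloor>T / \<epsilon>\<rfloor>}.
            ereal (1 / \<epsilon> * (W2 (S \<epsilon> ((S \<epsilon> ^^ k) (\<rho> 0))) (S \<epsilon> (\<rho> (real k * \<epsilon>)))
                          - W2 ((S \<epsilon> ^^ k) (\<rho> 0)) (\<rho> (real k * \<epsilon>))))) \<le> 0"
    and interpolation:
      "\<And>\<epsilon> k t. \<epsilon> > 0 \<Longrightarrow> t \<in> {real k * \<epsilon>..<(real k + 1) * \<epsilon>} \<Longrightarrow> \<rho>\<epsilon> \<epsilon> t = (S \<epsilon> ^^ k) (\<rho> 0)"
  shows "((\<lambda>\<epsilon>. SUP t\<in>{0..T}. ereal (W2 (\<rho>\<epsilon> \<epsilon> t) (\<rho> t))) \<longlongrightarrow> 0) (at_right 0)"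
proof (rule tendsto_of_small_SUP)
  fix e :: real assume "e > 0"
  \<comment> \<open>The tolerance per unit of time: the accumulated error is at most \<open>2 T \<eta> < e / 2\<close>, and the
      other half of \<open>e\<close> is left for the motion of \<open>\<rho>\<close> within a time cell.\<close>
  define \<eta> where "\<eta> = e / (4 * T + 4)"
  have \<eta>: "\<eta> > 0" "2 * T * \<eta> < e / 2"
    using \<open>e > 0\<close> T_pos by (auto simp: \<eta>_def field_simps)
  have curve: "ac_curve T \<rho>" and \<rho>_P2: "\<And>t. t \<in> {0..T} \<Longrightarrow> \<rho> t \<in> P2"
    using flow by (auto simp: gradient_flow_def ac_curve_def)
  obtain d where "d > 0" and d: "\<And>s t. 0 \<le> s \<Longrightarrow> s \<le> t \<Longrightarrow> t \<le> T \<Longrightarrow> t - s < d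
      \<Longrightarrow> W2 (\<rho> s) (\<rho> t) < e / 2"
    using ac_curve_uniformly_continuous[OF curve, of "e / 2"] \<open>e > 0\<close> by auto
  have "eventually (\<lambda>\<epsilon>. (SUP t\<in>{0..T - \<epsilon>}.
      ereal (1 / \<epsilon> * W2 (S \<epsilon> (\<rho> t)) (\<rho> (t + \<epsilon>)))) < ereal \<eta>) (at_right 0)"
    using consistency \<eta>(1) by (intro Limsup_lessD) simp
  moreover have "eventually (\<lambda>\<epsilon>. (SUP k\<in>{1..nat \<lfloor>T / \<epsilon>\<rfloor>}.
      ereal (1 / \<epsilon> * (W2 (S \<epsilon> ((S \<epsilon> ^^ k) (\<rho> 0))) (S \<epsilon> (\<rho> (real k * \<epsilon>)))
        - W2 ((S \<epsilon> ^^ k) (\<rho> 0)) (\<rho> (real k * \<epsilon>))))) < ereal \<eta>) (at_right 0)"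
    using contraction \<eta>(1) by (intro Limsup_lessD) (auto intro: le_less_trans)
  moreover have "eventually (\<lambda>\<epsilon>. \<epsilon> \<in> {0<..<d}) (at_right 0)"
    using \<open>d > 0\<close> by (rule eventually_at_right_real)
  ultimately show "eventually (\<lambda>\<epsilon>. \<forall>t\<in>{0..T}. W2 (\<rho>\<epsilon> \<epsilon> t) (\<rho> t) \<le> e) (at_right 0)"
  proof eventually_elim
    case (elim \<epsilon>)
    then have \<epsilon>: "\<epsilon> > 0" "\<epsilon> < d" by auto
    define n where "n = nat \<lfloor>T / \<epsilon>\<rfloor>"
    have grid: "real k * \<epsilon> \<in> {0..T}" if "k \<le> n" for k
    proof -
      have "real k \<le> T / \<epsilon>"
        using T_pos \<epsilon> of_nat_floor[of "T / \<epsilon>"]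
        by (intro order_trans[OF of_nat_mono[OF that]]) (simp add: n_def)
      then show ?thesis
        using \<epsilon> by (simp add: field_simps)
    qed
    have cons: "W2 (S \<epsilon> (\<rho> t)) (\<rho> (t + \<epsilon>)) \<le> \<eta> * \<epsilon>" if "t \<in> {0..T - \<epsilon>}" for t
    proof -
      have "ereal (1 / \<epsilon> * W2 (S \<epsilon> (\<rho> t)) (\<rho> (t + \<epsilon>))) \<le> ereal \<eta>"
        using that by (intro order_trans[OF SUP_upper less_imp_le[OF elim(1)]])
      then show ?thesis
        using \<epsilon> by (simp add: field_simps)
    qed
    have contr: "W2 (S \<epsilon> ((S \<epsilon> ^^ k) (\<rho> 0))) (S \<epsilon> (\<rho> (real k * \<epsilon>)))
        \<le> W2 ((S \<epsilon> ^^ k) (\<rho> 0)) (\<rho> (real k * \<epsilon>)) + \<eta> * \<epsilon>" if "k \<in> {1..n}" for k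
    proof -
      have "ereal (1 / \<epsilon> * (W2 (S \<epsilon> ((S \<epsilon> ^^ k) (\<rho> 0))) (S \<epsilon> (\<rho> (real k * \<epsilon>)))
          - W2 ((S \<epsilon> ^^ k) (\<rho> 0)) (\<rho> (real k * \<epsilon>)))) \<le> ereal \<eta>"
        using that unfolding n_def by (intro order_trans[OF SUP_upper less_imp_le[OF elim(2)]])
      then show ?thesis
        using \<epsilon> by (simp add: field_simps)
    qed
    have \<rho>0: "\<rho> 0 \<in> P2"
      using \<rho>_P2 T_pos by simp
    have step_P2: "S \<epsilon> \<mu> \<in> P2" if "\<mu> \<in> P2" for \<mu>
      using scheme \<epsilon> that by (auto simp: gradient_type_scheme_def)
    note iterate_P2 = scheme_iterate_in_P2[OF scheme \<epsilon>(1) \<rho>0]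
    define err where "err k = W2 ((S \<epsilon> ^^ k) (\<rho> 0)) (\<rho> (real k * \<epsilon>))" for k
    have err: "err k \<le> real k * (2 * \<eta> * \<epsilon>)" if "k \<le> n" for k
    proof (rule error_accumulation[OF _ _ that])
      show "err 0 \<le> 0"
        using W2_self[OF \<rho>0] by (simp add: err_def)
      fix k assume "k < n"
      then have k: "real k * \<epsilon> \<in> {0..T}" "real (Suc k) * \<epsilon> \<in> {0..T}"
        using grid[of k] grid[of "Suc k"] by auto
      have "err (Suc k) \<le> W2 (S \<epsilon> ((S \<epsilon> ^^ k) (\<rho> 0))) (S \<epsilon> (\<rho> (real k * \<epsilon>)))
          + W2 (S \<epsilon> (\<rho> (real k * \<epsilon>))) (\<rho> (real (Suc k) * \<epsilon>))"
        unfolding err_def funpow.simps comp_apply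
        by (intro W2_triangle step_P2 iterate_P2 \<rho>_P2 k)
      \<comment> \<open>Contraction is assumed only from \<open>k = 1\<close> on; at \<open>k = 0\<close> the two points coincide.\<close>
      also have "W2 (S \<epsilon> ((S \<epsilon> ^^ k) (\<rho> 0))) (S \<epsilon> (\<rho> (real k * \<epsilon>))) \<le> err k + \<eta> * \<epsilon>"
      proof (cases "k = 0")
        case True
        then show ?thesis
          using W2_self[OF step_P2[OF \<rho>0]] W2_self[OF \<rho>0] \<eta> \<epsilon> by (simp add: err_def)
      next
        case False
        then show ?thesis
          using contr[of k] \<open>k < n\<close> by (simp add: err_def)
      qed
      also have "W2 (S \<epsilon> (\<rho> (real k * \<epsilon>))) (\<rho> (real (Suc k) * \<epsilon>)) \<le> \<eta> * \<epsilon>"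
        using cons[of "real k * \<epsilon>"] k \<epsilon> by (simp add: algebra_simps)
      finally show "err (Suc k) \<le> err k + 2 * \<eta> * \<epsilon>"
        by (simp add: algebra_simps)
    qed
    show ?case
    proof
      fix t assume t: "t \<in> {0..T}"
      define k where "k = nat \<lfloor>t / \<epsilon>\<rfloor>"
      have "real k \<le> t / \<epsilon>" "t / \<epsilon> < real k + 1"
        using t \<epsilon> by (simp_all add: k_def)
      then have cell: "t \<in> {real k * \<epsilon>..<(real k + 1) * \<epsilon>}"
        using \<epsilon> by (simp add: field_simps)
      have "k \<le> n"
        unfolding k_def n_def using t \<epsilon> by (intro nat_mono floor_mono divide_right_mono) auto
      then have k: "real k * \<epsilon> \<in> {0..T}"
        by (rule grid)
      have "W2 (\<rho>\<epsilon> \<epsilon> t) (\<rho> t) \<le> err k + W2 (\<rho> (real k * \<epsilon>)) (\<rho> t)"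
        unfolding interpolation[OF \<epsilon>(1) cell] err_def
        by (intro W2_triangle iterate_P2 \<rho>_P2 k t)
      also have "err k \<le> 2 * \<eta> * (real k * \<epsilon>)"
        using err[OF \<open>k \<le> n\<close>] by (simp add: algebra_simps)
      also have "\<dots> \<le> 2 * \<eta> * T"
        using k \<eta> by (intro mult_left_mono) auto
      also have "\<dots> \<le> e / 2"
        using \<eta> by (simp add: algebra_simps)
      also have "W2 (\<rho> (real k * \<epsilon>)) (\<rho> t) \<le> e / 2"
        using cell k t \<epsilon> by (intro less_imp_le[OF d]) (auto simp: algebra_simps)
      finally show "W2 (\<rho>\<epsilon> \<epsilon> t) (\<rho> t) \<le> e"
        by simp
    qed
  qed
next
  show "0 \<le> W2 (\<rho>\<epsilon> \<epsilon> t) (\<rho> t)" for \<epsilon> t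
    by (rule W2_nonneg)
  show "{0..T} \<noteq> {}"
    using T_pos by simp
qed

end
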